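(* If $f\in L(\mathbb{R}^2)$ is piecewise smooth and continuous on some open set $\Omega\subset \mathbb{R}^2$, then $A_\alpha f$ converges to $f$ uniformly on compact subsets of $\Omega$ as $\alpha \to 0$ (with $\alpha>0$).
   Context: $L(\mathbb{R}^2)$ denotes the space of (Lebesgue) integrable functions on $\mathbb{R}^2$; functions are complex-valued unless stated otherwise. Piecewise smooth functions: a function $f$ is a simple piecewise smooth function if $f(x) = F(x)\chi_D(x)$, where $F$ is differentiable on $\mathbb{R}^2$, $D \subset \mathbb{R}^2$ has a piecewise smooth boundary that does not intersect itself, and $\chi_D(x) = 1$ if $x \in D \cup \partial D$, $\chi_D(x) = 0$ if $x \notin D\cup\partial D$. A function is piecewise smooth if it is a finite linear combination of simple piecewise smooth functions. Radon transform: for $f\in L(\mathbb{R}^2)$, $0\le\psi<\pi$ and $t \in \mathbb{R}$, $$Rf(t,\psi) = \int_{-\infty}^\infty f(t\cos\psi - u\sin\psi,\ t\sin\psi + u\cos\psi)\, du,$$ i.e. the integral of $f$ over the line orthogonal to the unit vector $\mathbf{n} = (\cos\psi,\sin\psi)$ and passing through $t\mathbf{n}$. By Fubini's theorem it exists for almost all $\psi\in[0,\pi)$ and $t\in\mathbb{R}$. Operator $A_\alpha$: for $\alpha>0$ and $x=(x_1,x_2)\in\mathbb{R}^2$, $$A_\alpha f(x) = \int_0^\pi d\psi \int_{-\infty}^\infty \Phi_\alpha(x,t,\psi)\, Rf(t,\psi)\, dt,$$ $$\Phi_\alpha(x,t,\psi) = \frac{1}{2\pi^2}\,\frac{\alpha^2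 - (x_1\cos\psi + x_2\sin\psi - t)^2}{[\alpha^2 + (x_1\cos\psi + x_2\sin\psi - t)^2]^2}.$$ *)

theory Defs
  imports "HOL-Analysis.Analysis"
begin

text \<open>
  The plane is \<^typ>\<open>real \<times> real\<close>, whose norm is the Euclidean one.

  A boundary curve that does not intersect itself is either a simple closed curve or, since the
  region is not required to be bounded, a curve without endpoints running to infinity in both
  directions. ``Smooth'' is read as continuously differentiable; a vanishing tangent is allowed.
\<close>

definition simple_closed_curve :: "(real \<times> real) set \<Rightarrow> bool" where
  "simple_closed_curve C \<longleftrightarrow>
     (\<exists>\<gamma>. valid_path \<gamma> \<and> simple_path \<gamma> \<and> pathfinish \<gamma> = pathstart \<gamma> \<and> C = path_image \<gamma>)"

definition simple_unbounded_curve :: "(real \<times> real) set \<Rightarrow> bool" where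
  "simple_unbounded_curve C \<longleftrightarrow>
     (\<exists>\<gamma>. (\<forall>a b. \<gamma> piecewise_C1_differentiable_on {a..b}) \<and> inj \<gamma> \<and>
          filterlim \<gamma> at_infinity at_infinity \<and> C = range \<gamma>)"

text \<open>
  The boundary may have several components, as for an annulus or a strip; they must not meet.
  The empty family gives the region \<^const>\<open>UNIV\<close>, so differentiable functions are themselves
  piecewise smooth.
\<close>

definition has_piecewise_smooth_boundary :: "(real \<times> real) set \<Rightarrow> bool" where
  "has_piecewise_smooth_boundary D \<longleftrightarrow>
     (\<exists>\<C>. finite \<C> \<and> pairwise disjnt \<C> \<and>
          (\<forall>C\<in>\<C>. simple_closed_curve C \<or> simple_unbounded_curve C) \<and> frontier D = \<Union>\<C>)"

definition simple_piecewise_smooth :: "(real \<times> real \<Rightarrow> complex) \<Rightarrow> bool" where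
  "simple_piecewise_smooth f \<longleftrightarrow>
     (\<exists>F D. F differentiable_on UNIV \<and> has_piecewise_smooth_boundary D \<and>
            f = (\<lambda>x. F x * indicator (D \<union> frontier D) x))"

definition piecewise_smooth :: "(real \<times> real \<Rightarrow> complex) \<Rightarrow> bool" where
  "piecewise_smooth f \<longleftrightarrow>
     (\<exists>(n::nat) c g. (\<forall>k<n. simple_piecewise_smooth (g k)) \<and> f = (\<lambda>x. \<Sum>k<n. c k * g k x))"

text \<open>
  Integrals are taken over \<^const>\<open>lebesgue\<close> rather than \<^const>\<open>lborel\<close>, so that Lebesgue
  measurable functions that are not Borel measurable are integrated properly. The library sets
  the integral of a non-integrable function to 0; for integrable f this affects
  \<open>radon f t \<psi>\<close> only on a null set of \<open>(t, \<psi>)\<close>.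
\<close>

definition radon :: "(real \<times> real \<Rightarrow> complex) \<Rightarrow> real \<Rightarrow> real \<Rightarrow> complex" where
  "radon f t \<psi> = (LINT u|lebesgue. f (t * cos \<psi> - u * sin \<psi>, t * sin \<psi> + u * cos \<psi>))"

definition Phi :: "real \<Rightarrow> real \<times> real \<Rightarrow> real \<Rightarrow> real \<Rightarrow> real" where
  "Phi \<alpha> x t \<psi> =
     1 / (2 * pi\<^sup>2) *
     ((\<alpha>\<^sup>2 - (fst x * cos \<psi> + snd x * sin \<psi> - t)\<^sup>2) /
      (\<alpha>\<^sup>2 + (fst x * cos \<psi> + snd x * sin \<psi> - t)\<^sup>2)\<^sup>2)"

definition A_op :: "real \<Rightarrow> (real \<times> real \<Rightarrow> complex) \<Rightarrow> real \<times> real \<Rightarrow> complex" where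
  "A_op \<alpha> f x =
     (LINT \<psi>:{0..<pi}|lebesgue. (LINT t|lebesgue. complex_of_real (Phi \<alpha> x t \<psi>) * radon f t \<psi>))"

end

theory Submission
  imports Defs
begin

text \<open>
  The operator \<^const>\<open>A_op\<close> is convolution with the Poisson kernel of the half-space over the plane,
  \<open>P\<^sub>\<alpha>(y) = \<alpha> / (2\<pi> (\<alpha>\<^sup>2 + |y|\<^sup>2)\<^bsup>3/2\<^esup>)\<close>, and the Poisson kernels form an approximate identity.

  To see the first point, fix an angle \<open>\<psi>\<close> and rotate the plane so that \<open>(cos \<psi>, sin \<psi>)\<close> becomes the first
  axis. The integral over \<open>t\<close> of the integrals over the lines is then, by Fubini, an integral over the
  plane of \<open>f(y)\<close> against a ridge function of \<open>y\<close> (\<open>integral_Phi_radon\<close>). Since that ridge function is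
  bounded, the integrals over \<open>\<psi>\<close> and \<open>y\<close> may be exchanged, and averaging the ridge functions over all
  directions gives a radial function of \<open>x - y\<close>. If \<open>x - y\<close> has polar coordinates \<open>r\<close> and \<open>\<theta>\<close>, the ridge
  function is a constant multiple of \<open>(\<alpha>\<^sup>2 - s\<^sup>2) / (\<alpha>\<^sup>2 + s\<^sup>2)\<^sup>2\<close> with \<open>s = r cos (\<psi> - \<theta>)\<close>. Now
  \<open>(\<alpha>\<^sup>2 - s\<^sup>2) / (\<alpha>\<^sup>2 + s\<^sup>2)\<^sup>2\<close> is minus the derivative of \<open>\<alpha> / (\<alpha>\<^sup>2 + s\<^sup>2)\<close> with respect to \<open>\<alpha>\<close>, and
  the integral of \<open>\<alpha> / (\<alpha>\<^sup>2 + r\<^sup>2 cos\<^sup>2 \<psi>)\<close> over a period is \<open>\<pi> / sqrt (\<alpha>\<^sup>2 + r\<^sup>2)\<close>,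
  so the integral over \<open>\<psi>\<close> is the Poisson kernel (\<open>has_bochner_integral_angular\<close>,
  \<open>A_op_eq_poisson_convolution\<close>). Piecewise smooth functions are Borel measurable, which makes
  Lebesgue integrals over lines and over the plane agree with Borel ones and gives access to Fubini.

  For the second point, the kernel is nonnegative and has integral 1, and at distance at least \<open>d\<close> from the
  origin it is at most \<open>\<alpha>\<close> times a constant multiple of \<open>P\<^sub>1\<close>. Hence the mass near \<open>x\<close> sees only the
  oscillation of \<open>f\<close> on a small ball, which is uniformly small for \<open>x\<close> in a compact subset of
  \<open>\<Omega>\<close>, while the remaining contribution is \<open>O(\<alpha>)\<close> because \<open>f\<close> is integrable
  (\<open>uniform_limit_poisson_convolution\<close>).
\<close>

section \<open>Measurability of piecewise smooth functions\<close>

text \<open>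
  Differentiable functions are continuous, and \<open>D \<union> frontier D\<close> is closed because it is the closure of \<open>D\<close>.
\<close>

lemma piecewise_smooth_borel_measurable:
  assumes "piecewise_smooth f"
  shows "f \<in> borel_measurable borel"
proof -
  have simple: "g \<in> borel_measurable borel" if g: "simple_piecewise_smooth g" for g
  proof -
    obtain F D where F: "F differentiable_on UNIV"
      and g_eq: "g = (\<lambda>x. F x * indicator (D \<union> frontier D) x)"
      using g unfolding simple_piecewise_smooth_def by blast
    have [measurable]: "F \<in> borel_measurable borel"
      using F by (intro borel_measurable_continuous_onI differentiable_imp_continuous_on)
    have [measurable]: "D \<union> frontier D \<in> sets borel"
      by (metis borel_closed closed_closure closure_Un_frontier)
    show ?thesis
      unfolding g_eq by measurable
  qed
  obtain n :: nat and c g where "\<forall>k<n. simple_piecewise_smooth (g k)"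
    and "f = (\<lambda>x. \<Sum>k<n. c k * g k x)"
    using assms unfolding piecewise_smooth_def by blast
  then show ?thesis
    using simple by (auto intro!: borel_measurable_sum borel_measurable_times)
qed

section \<open>Rotation invariance of planar Lebesgue measure\<close>

text \<open>
  On each horizontal line the shear is a translation, so Fubini reduces the claim to the translation
  invariance of Lebesgue measure on the line.
\<close>

lemma distr_lborel_shear_fst:
  "distr lborel lborel (\<lambda>z. (fst z + a * snd z, snd z)) = (lborel :: (real \<times> real) measure)"
proof (rule measure_eqI)
  fix A :: "(real \<times> real) set"
  assume "A \<in> sets (distr lborel lborel (\<lambda>z. (fst z + a * snd z, snd z)))"
  then have A [measurable]: "A \<in> sets borel" by simp
  have T [measurable]: "(\<lambda>z. (fst z + a * snd z, snd z)) \<in> borel \<rightarrow>\<^sub>M (borel :: (real \<times> real) measure)"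
    by (intro borel_measurable_continuous_onI continuous_intros)
  have I [measurable]: "indicator A \<in> borel_measurable (lborel \<Otimes>\<^sub>M lborel :: (real \<times> real) measure)"
    by (simp add: lborel_prod)
  have J: "(\<lambda>z. indicator A (fst z + a * snd z, snd z) :: ennreal) \<in> borel_measurable (lborel \<Otimes>\<^sub>M lborel)"
    unfolding lborel_prod by measurable
  have "emeasure (distr lborel lborel (\<lambda>z. (fst z + a * snd z, snd z))) A
      = (\<integral>\<^sup>+z. indicator A z \<partial>distr lborel lborel (\<lambda>z. (fst z + a * snd z, snd z)))"
    by simp
  also have "\<dots> = (\<integral>\<^sup>+z. indicator A (fst z + a * snd z, snd z) \<partial>lborel)"
    by (subst nn_integral_distr) auto
  also have "\<dots> = (\<integral>\<^sup>+y. (\<integral>\<^sup>+x. indicator A (x + a * y, y) \<partial>lborel) \<partial>lborel)"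
    using lborel_pair.nn_integral_snd[OF J[unfolded split_beta']] by (simp add: lborel_prod)
  also have "\<dots> = (\<integral>\<^sup>+y. (\<integral>\<^sup>+x. indicator A (x, y) \<partial>lborel) \<partial>lborel)"
  proof (rule nn_integral_cong)
    fix y :: real
    have "(\<lambda>x. indicator A (x, y) :: ennreal) \<in> borel_measurable borel"
      using measurable_Pair1'[of y lborel lborel] by measurable
    then have "(\<integral>\<^sup>+x. indicator A (x, y) \<partial>lborel) = (\<integral>\<^sup>+x. indicator A (a * y + 1 * x, y) \<partial>lborel)"
      using nn_integral_real_affine[of "\<lambda>x. indicator A (x, y)" 1 "a * y"] by simp
    then show "(\<integral>\<^sup>+x. indicator A (x + a * y, y) \<partial>lborel) = (\<integral>\<^sup>+x. indicator A (x, y) \<partial>lborel)"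
      by (simp add: add.commute)
  qed
  also have "\<dots> = (\<integral>\<^sup>+z. indicator A z \<partial>lborel)"
    using lborel_pair.nn_integral_snd[OF I] by (simp add: lborel_prod)
  also have "\<dots> = emeasure lborel A" by simp
  finally show "emeasure (distr lborel lborel (\<lambda>z. (fst z + a * snd z, snd z))) A = emeasure lborel A" .
qed simp

lemma distr_lborel_swap: "distr lborel lborel prod.swap = (lborel :: (real \<times> real) measure)"
proof -
  have "prod.swap = (\<lambda>(x, y). (y, x :: real) :: real \<times> real)"
    by (simp add: fun_eq_iff)
  moreover have "distr (lborel \<Otimes>\<^sub>M lborel) (lborel \<Otimes>\<^sub>M lborel) (\<lambda>(x, y). (y, x))
      = (lborel \<Otimes>\<^sub>M lborel :: (real \<times> real) measure)"
    by (rule lborel_pair.distr_pair_swap[symmetric])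
  ultimately show ?thesis
    by (simp only: lborel_prod)
qed

lemma distr_lborel_shear_snd:
  "distr lborel lborel (\<lambda>z. (fst z, snd z + a * fst z)) = (lborel :: (real \<times> real) measure)"
proof -
  define S where "S = (\<lambda>z :: real \<times> real. (fst z + a * snd z, snd z))"
  have meas [measurable]: "S \<in> lborel \<rightarrow>\<^sub>M lborel"
    "(prod.swap :: real \<times> real \<Rightarrow> _) \<in> lborel \<rightarrow>\<^sub>M lborel"
    unfolding S_def prod.swap_def measurable_lborel1 measurable_lborel2
    by (intro borel_measurable_continuous_onI continuous_intros)+
  have "(\<lambda>z. (fst z, snd z + a * fst z)) = prod.swap \<circ> S \<circ> prod.swap"
    by (simp add: S_def fun_eq_iff)
  moreover have "distr lborel lborel (prod.swap \<circ> S \<circ> prod.swap)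
      = distr (distr (distr lborel lborel prod.swap) lborel S) lborel prod.swap"
    by (subst distr_distr, measurable)+ (simp add: comp_assoc)
  ultimately show ?thesis
    using distr_lborel_shear_fst[of a] by (simp add: distr_lborel_swap flip: S_def)
qed

definition rotation :: "real \<Rightarrow> real \<times> real \<Rightarrow> real \<times> real" where
  "rotation \<psi> z = (fst z * cos \<psi> - snd z * sin \<psi>, fst z * sin \<psi> + snd z * cos \<psi>)"

lemma borel_measurable_rotation [measurable]: "rotation \<psi> \<in> borel \<rightarrow>\<^sub>M borel"
  unfolding rotation_def by (intro borel_measurable_continuous_onI continuous_intros)

text \<open>
  Shears preserve area, so this factorisation proves that rotations do. The excluded half turn would
  need an infinite shear.
\<close>

lemma rotation_eq_shears:
  assumes "0 \<le> \<psi>" "\<psi> < pi"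
  shows "rotation \<psi> = (\<lambda>z. (fst z - tan (\<psi> / 2) * snd z, snd z))
           \<circ> (\<lambda>z. (fst z, snd z + sin \<psi> * fst z)) \<circ> (\<lambda>z. (fst z - tan (\<psi> / 2) * snd z, snd z))"
proof -
  define c s where "c = cos (\<psi> / 2)" and "s = sin (\<psi> / 2)"
  have c: "c \<noteq> 0"
    using assms cos_gt_zero_pi[of "\<psi> / 2"] by (simp add: c_def)
  have cs: "cos \<psi> = c\<^sup>2 - s\<^sup>2" "sin \<psi> = 2 * s * c" "s\<^sup>2 = 1 - c\<^sup>2"
    using cos_double[of "\<psi> / 2"] sin_double[of "\<psi> / 2"] by (simp_all add: c_def s_def sin_squared_eq)
  have t: "tan (\<psi> / 2) = s / c"
    by (simp add: tan_def c_def s_def)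
  have 1: "1 - tan (\<psi> / 2) * sin \<psi> = cos \<psi>"
    unfolding t cs(1,2) using c cs(3) by (simp add: field_simps power2_eq_square)
  have 2: "tan (\<psi> / 2) * (1 + cos \<psi>) = sin \<psi>"
  proof -
    have "1 + cos \<psi> = 2 * c\<^sup>2"
      using cs by simp
    then show ?thesis
      unfolding t using c cs(2) by (simp add: power2_eq_square)
  qed
  show ?thesis
  proof
    fix z :: "real \<times> real"
    have "snd z + sin \<psi> * (fst z - tan (\<psi> / 2) * snd z)
        = fst z * sin \<psi> + snd z * (1 - tan (\<psi> / 2) * sin \<psi>)"
      by (simp add: algebra_simps)
    moreover have "fst z - tan (\<psi> / 2) * snd z - tan (\<psi> / 2) * (fst z * sin \<psi> + snd z * cos \<psi>)
        = fst z * (1 - tan (\<psi> / 2) * sin \<psi>) - snd z * (tan (\<psi> / 2) * (1 + cos \<psi>))"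
      by (simp add: algebra_simps)
    ultimately show "rotation \<psi> z = ((\<lambda>z. (fst z - tan (\<psi> / 2) * snd z, snd z))
           \<circ> (\<lambda>z. (fst z, snd z + sin \<psi> * fst z)) \<circ> (\<lambda>z. (fst z - tan (\<psi> / 2) * snd z, snd z))) z"
      unfolding 1 2 by (simp add: rotation_def)
  qed
qed

lemma distr_lborel_rotation:
  assumes "0 \<le> \<psi>" "\<psi> < pi"
  shows "distr lborel lborel (rotation \<psi>) = lborel"
proof -
  define S where "S = (\<lambda>z :: real \<times> real. (fst z - tan (\<psi> / 2) * snd z, snd z))"
  define T where "T = (\<lambda>z :: real \<times> real. (fst z, snd z + sin \<psi> * fst z))"
  have S: "distr lborel lborel S = lborel" and T: "distr lborel lborel T = lborel"
    using distr_lborel_shear_fst[of "- tan (\<psi> / 2)"] distr_lborel_shear_snd[of "sin \<psi>"]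
    by (simp_all add: S_def T_def)
  have [measurable]: "S \<in> lborel \<rightarrow>\<^sub>M lborel" "T \<in> lborel \<rightarrow>\<^sub>M lborel"
    unfolding S_def T_def measurable_lborel1 measurable_lborel2
    by (intro borel_measurable_continuous_onI continuous_intros)+
  have "distr lborel lborel (S \<circ> T \<circ> S) = distr (distr (distr lborel lborel S) lborel T) lborel S"
    by (subst distr_distr, measurable)+ (simp add: comp_assoc)
  then show ?thesis
    by (simp add: S T rotation_eq_shears[OF assms] flip: S_def T_def)
qed

section \<open>Averaging the ridge functions over all directions\<close>

text \<open>
  The Poisson kernel of the upper half-space in three dimensions, at height \<open>\<alpha>\<close> above the plane.
\<close>

definition poisson_kernel :: "real \<Rightarrow> real \<times> real \<Rightarrow> real" where
  "poisson_kernel \<alpha> y = \<alpha> / (2 * pi * sqrt (\<alpha>\<^sup>2 + (norm y)\<^sup>2) ^ 3)"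

lemma borel_measurable_poisson [measurable]: "poisson_kernel \<alpha> \<in> borel_measurable borel"
  unfolding poisson_kernel_def by measurable

text \<open>
  An antiderivative of \<open>\<alpha> / (\<alpha>\<^sup>2 + r\<^sup>2 cos\<^sup>2 \<phi>)\<close> is \<open>arctan (k tan \<phi>) / R\<close>. Its jumps disappear
  once \<open>arctan (k tan \<phi>)\<close> is continued as
  \<open>\<phi> + arctan ((k - 1) sin \<phi> cos \<phi> / (cos\<^sup>2 \<phi> + k sin\<^sup>2 \<phi>))\<close>. The function below is, up to a constant,
  minus the derivative of this continuation divided by \<open>R\<close> with respect to \<open>\<alpha>\<close>, at \<open>\<phi> = \<psi> - \<theta>\<close>: the first
  term comes from \<open>1 / R\<close>, the second from \<open>k\<close>.
\<close>

lemma has_real_derivative_angular_antiderivative: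
  fixes \<alpha> r \<theta> \<psi> :: real
  assumes "\<alpha> > 0"
  defines "R \<equiv> sqrt (\<alpha>\<^sup>2 + r\<^sup>2)"
  defines "k \<equiv> \<alpha> / R"
  defines "c \<equiv> \<lambda>\<psi>. cos (\<psi> - \<theta>)" and "s \<equiv> \<lambda>\<psi>. sin (\<psi> - \<theta>)"
  shows "((\<lambda>\<psi>. \<alpha> / R ^ 3 * (\<psi> + arctan ((k - 1) * s \<psi> * c \<psi> / ((c \<psi>)\<^sup>2 + k * (s \<psi>)\<^sup>2)))
             - r\<^sup>2 / R\<^sup>2 * (s \<psi> * c \<psi> / (\<alpha>\<^sup>2 + r\<^sup>2 * (c \<psi>)\<^sup>2)))
           has_real_derivative (\<alpha>\<^sup>2 - r\<^sup>2 * (c \<psi>)\<^sup>2) / (\<alpha>\<^sup>2 + r\<^sup>2 * (c \<psi>)\<^sup>2)\<^sup>2) (at \<psi>)"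
proof -
  have R: "R > 0" "R\<^sup>2 = \<alpha>\<^sup>2 + r\<^sup>2"
    using assms by (auto simp: R_def add_pos_nonneg)
  have k: "k > 0"
    using R assms by (simp add: k_def)
  define C where "C = c \<psi>"
  define S where "S = s \<psi>"
  have CS: "C\<^sup>2 + S\<^sup>2 = 1"
    by (simp add: C_def S_def c_def s_def)
  have dc: "(c has_real_derivative - S) (at \<psi>)" and ds: "(s has_real_derivative C) (at \<psi>)"
    unfolding c_def s_def S_def C_def by (auto intro!: derivative_eq_intros)
  have D0: "C\<^sup>2 + k * S\<^sup>2 > 0"
    using CS k by (cases "S = 0") (auto intro: add_nonneg_pos)
  define Q where "Q = \<alpha>\<^sup>2 + r\<^sup>2 * C\<^sup>2"
  have Q: "Q > 0"
    using assms by (auto simp: Q_def add_pos_nonneg)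
  have kQ: "C\<^sup>2 + k\<^sup>2 * S\<^sup>2 = Q / R\<^sup>2"
  proof -
    have "R\<^sup>2 * C\<^sup>2 + \<alpha>\<^sup>2 * S\<^sup>2 = \<alpha>\<^sup>2 * (C\<^sup>2 + S\<^sup>2) + r\<^sup>2 * C\<^sup>2"
      unfolding R(2) by (simp add: algebra_simps)
    also have "\<dots> = Q"
      unfolding CS Q_def by simp
    finally show ?thesis
      using R(1) by (simp add: k_def field_simps)
  qed
  \<comment> \<open>The continued arc tangent has the derivative of \<open>arctan (k tan \<phi>)\<close> everywhere.\<close>
  let ?q = "\<lambda>\<psi>. (k - 1) * s \<psi> * c \<psi> / ((c \<psi>)\<^sup>2 + k * (s \<psi>)\<^sup>2)"
  have q: "(?q has_real_derivative (k - 1) * (C\<^sup>2 - k * S\<^sup>2) / (C\<^sup>2 + k * S\<^sup>2)\<^sup>2) (at \<psi>)"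
  proof -
    have "(?q has_real_derivative
        ((((k - 1) * C) * C + (- S) * ((k - 1) * S)) * (C\<^sup>2 + k * S\<^sup>2)
          - ((k - 1) * S * C) * (2 * C * (- S) + k * (2 * S * C))) / ((C\<^sup>2 + k * S\<^sup>2) * (C\<^sup>2 + k * S\<^sup>2))) (at \<psi>)"
      using D0 by (auto intro!: derivative_eq_intros dc ds simp: mult_ac simp flip: C_def S_def)
    moreover have "(((k - 1) * C) * C + (- S) * ((k - 1) * S)) * (C\<^sup>2 + k * S\<^sup>2)
          - ((k - 1) * S * C) * (2 * C * (- S) + k * (2 * S * C)) = (k - 1) * (C\<^sup>2 - k * S\<^sup>2) * (C\<^sup>2 + S\<^sup>2)"
      by (simp add: algebra_simps power2_eq_square)
    ultimately show ?thesis
      by (simp only: CS mult_1_right power2_eq_square[of "C\<^sup>2 + k * S\<^sup>2"])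
  qed
  have A: "((\<lambda>\<psi>. \<psi> + arctan (?q \<psi>)) has_real_derivative k / (C\<^sup>2 + k\<^sup>2 * S\<^sup>2)) (at \<psi>)"
  proof -
    have "((\<lambda>\<psi>. \<psi> + arctan (?q \<psi>)) has_real_derivative
        1 + inverse (1 + (?q \<psi>)\<^sup>2) * ((k - 1) * (C\<^sup>2 - k * S\<^sup>2) / (C\<^sup>2 + k * S\<^sup>2)\<^sup>2)) (at \<psi>)"
      by (rule DERIV_add[OF DERIV_ident DERIV_chain2[OF DERIV_arctan q]])
    then have "((\<lambda>\<psi>. \<psi> + arctan (?q \<psi>)) has_real_derivative
        1 + ((k - 1) * (C\<^sup>2 - k * S\<^sup>2) / (C\<^sup>2 + k * S\<^sup>2)\<^sup>2) / (1 + (?q \<psi>)\<^sup>2)) (at \<psi>)"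
      by (simp only: divide_real_def[of _ "1 + _"] mult.commute)
    moreover have "1 + ((k - 1) * (C\<^sup>2 - k * S\<^sup>2) / (C\<^sup>2 + k * S\<^sup>2)\<^sup>2) / (1 + (?q \<psi>)\<^sup>2)
        = k / (C\<^sup>2 + k\<^sup>2 * S\<^sup>2)"
    proof -
      have pos: "C\<^sup>2 + k\<^sup>2 * S\<^sup>2 > 0"
        unfolding kQ using Q R(1) by simp
      have "(C\<^sup>2 + k * S\<^sup>2)\<^sup>2 + ((k - 1) * S * C)\<^sup>2 = (C\<^sup>2 + k\<^sup>2 * S\<^sup>2) * (C\<^sup>2 + S\<^sup>2)"
        by (simp add: algebra_simps power2_eq_square)
      then have "1 + (?q \<psi>)\<^sup>2 = (C\<^sup>2 + k\<^sup>2 * S\<^sup>2) / (C\<^sup>2 + k * S\<^sup>2)\<^sup>2"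
        using D0 by (simp add: CS power_divide add_divide_eq_iff flip: C_def S_def)
      then have "1 + ((k - 1) * (C\<^sup>2 - k * S\<^sup>2) / (C\<^sup>2 + k * S\<^sup>2)\<^sup>2) / (1 + (?q \<psi>)\<^sup>2)
          = 1 + (k - 1) * (C\<^sup>2 - k * S\<^sup>2) / (C\<^sup>2 + k\<^sup>2 * S\<^sup>2)"
        using D0 by simp
      also have "\<dots> = (C\<^sup>2 + k\<^sup>2 * S\<^sup>2 + (k - 1) * (C\<^sup>2 - k * S\<^sup>2)) / (C\<^sup>2 + k\<^sup>2 * S\<^sup>2)"
        using pos by (simp add: add_divide_eq_iff)
      also have "C\<^sup>2 + k\<^sup>2 * S\<^sup>2 + (k - 1) * (C\<^sup>2 - k * S\<^sup>2) = k * (C\<^sup>2 + S\<^sup>2)"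
        by (simp add: algebra_simps power2_eq_square)
      finally show ?thesis
        by (simp add: CS)
    qed
    ultimately show ?thesis
      by simp
  qed
  have B: "((\<lambda>\<psi>. s \<psi> * c \<psi> / (\<alpha>\<^sup>2 + r\<^sup>2 * (c \<psi>)\<^sup>2)) has_real_derivative
      ((C\<^sup>2 - S\<^sup>2) * Q + 2 * r\<^sup>2 * S\<^sup>2 * C\<^sup>2) / Q\<^sup>2) (at \<psi>)"
  proof -
    have "((\<lambda>\<psi>. s \<psi> * c \<psi> / (\<alpha>\<^sup>2 + r\<^sup>2 * (c \<psi>)\<^sup>2)) has_real_derivative
      ((C * C + (- S) * S) * Q - (S * C) * (r\<^sup>2 * (2 * C * (- S)))) / (Q * Q)) (at \<psi>)"
      using Q by (auto intro!: derivative_eq_intros dc ds simp: Q_def simp flip: C_def S_def)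
    then show ?thesis
      by (simp add: algebra_simps power2_eq_square)
  qed
  have "\<alpha> / R ^ 3 * (k / (C\<^sup>2 + k\<^sup>2 * S\<^sup>2)) - r\<^sup>2 / R\<^sup>2 * (((C\<^sup>2 - S\<^sup>2) * Q + 2 * r\<^sup>2 * S\<^sup>2 * C\<^sup>2) / Q\<^sup>2)
      = (\<alpha>\<^sup>2 - r\<^sup>2 * C\<^sup>2) / Q\<^sup>2"
  proof -
    have 1: "\<alpha> / R ^ 3 * (k / (C\<^sup>2 + k\<^sup>2 * S\<^sup>2)) = \<alpha>\<^sup>2 / (R\<^sup>2 * Q)"
      unfolding kQ using R(1) Q by (simp add: k_def field_simps power2_eq_square power3_eq_cube)
    have S2: "S\<^sup>2 = 1 - C\<^sup>2"
      using CS by simp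
    have 2: "\<alpha>\<^sup>2 * Q - r\<^sup>2 * ((C\<^sup>2 - S\<^sup>2) * Q + 2 * r\<^sup>2 * S\<^sup>2 * C\<^sup>2) = (\<alpha>\<^sup>2 - r\<^sup>2 * C\<^sup>2) * R\<^sup>2"
      unfolding S2 R(2) Q_def by (simp add: algebra_simps power2_eq_square)
    have "\<alpha>\<^sup>2 / (R\<^sup>2 * Q) - r\<^sup>2 / R\<^sup>2 * (((C\<^sup>2 - S\<^sup>2) * Q + 2 * r\<^sup>2 * S\<^sup>2 * C\<^sup>2) / Q\<^sup>2)
      = (\<alpha>\<^sup>2 * Q - r\<^sup>2 * ((C\<^sup>2 - S\<^sup>2) * Q + 2 * r\<^sup>2 * S\<^sup>2 * C\<^sup>2)) / (R\<^sup>2 * Q\<^sup>2)"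
    proof -
      have "\<alpha>\<^sup>2 / (R\<^sup>2 * Q) = \<alpha>\<^sup>2 * Q / (R\<^sup>2 * Q\<^sup>2)"
        using Q by (simp add: power2_eq_square)
      then show ?thesis
        by (simp add: diff_divide_distrib)
    qed
    also have "\<dots> = (\<alpha>\<^sup>2 - r\<^sup>2 * C\<^sup>2) / Q\<^sup>2"
      unfolding 2 using R(1) by simp
    finally show ?thesis
      unfolding 1 .
  qed
  then show ?thesis
    using DERIV_diff[OF DERIV_cmult[OF A, of "\<alpha> / R ^ 3"] DERIV_cmult[OF B, of "r\<^sup>2 / R\<^sup>2"]]
    by (simp add: C_def S_def Q_def)
qed

text \<open>
  The correction terms of the antiderivative have period \<open>\<pi>\<close>, so only its linear part
  \<open>\<alpha> \<psi> / R\<^sup>3\<close> contributes.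
\<close>

lemma has_bochner_integral_angular:
  fixes z :: "real \<times> real"
  assumes "\<alpha> > 0"
  shows "has_bochner_integral lborel
    (\<lambda>\<psi>. (\<alpha>\<^sup>2 - (fst z * cos \<psi> + snd z * sin \<psi>)\<^sup>2) / (\<alpha>\<^sup>2 + (fst z * cos \<psi> + snd z * sin \<psi>)\<^sup>2)\<^sup>2
          * indicator {0..<pi} \<psi>) (2 * pi\<^sup>2 * poisson_kernel \<alpha> z)"
proof -
  define r where "r = norm z"
  obtain \<theta> where \<theta>: "fst z = r * cos \<theta>" "snd z = r * sin \<theta>"
  proof -
    define w where "w = Complex (fst z) (snd z)"
    have r: "r = cmod w"
      by (simp add: w_def r_def cmod_def norm_prod_def)
    have w: "w = rcis r (Arg w)"
      unfolding r by (rule rcis_cmod_Arg[symmetric])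
    show thesis
    proof
      show "fst z = r * cos (Arg w)"
        using arg_cong[OF w, of Re] unfolding Re_rcis by (simp only: w_def complex.sel)
      show "snd z = r * sin (Arg w)"
        using arg_cong[OF w, of Im] unfolding Im_rcis by (simp only: w_def complex.sel)
    qed
  qed
  have proj: "fst z * cos \<psi> + snd z * sin \<psi> = r * cos (\<psi> - \<theta>)" for \<psi>
    by (simp add: \<theta> cos_diff algebra_simps)
  let ?g = "\<lambda>\<psi>. (\<alpha>\<^sup>2 - r\<^sup>2 * (cos (\<psi> - \<theta>))\<^sup>2) / (\<alpha>\<^sup>2 + r\<^sup>2 * (cos (\<psi> - \<theta>))\<^sup>2)\<^sup>2"
  define R where "R = sqrt (\<alpha>\<^sup>2 + r\<^sup>2)"
  define P where "P = (\<lambda>\<psi>. (\<alpha> / R - 1) * sin (\<psi> - \<theta>) * cos (\<psi> - \<theta>)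
    / ((cos (\<psi> - \<theta>))\<^sup>2 + \<alpha> / R * (sin (\<psi> - \<theta>))\<^sup>2))"
  define W where "W = (\<lambda>\<psi>. sin (\<psi> - \<theta>) * cos (\<psi> - \<theta>) / (\<alpha>\<^sup>2 + r\<^sup>2 * (cos (\<psi> - \<theta>))\<^sup>2))"
  define G where "G = (\<lambda>\<psi>. \<alpha> / R ^ 3 * (\<psi> + arctan (P \<psi>)) - r\<^sup>2 / R\<^sup>2 * W \<psi>)"
  have nz: "\<alpha>\<^sup>2 + r\<^sup>2 * (cos \<phi>)\<^sup>2 \<noteq> 0" for \<phi>
  proof -
    have "\<alpha>\<^sup>2 + r\<^sup>2 * (cos \<phi>)\<^sup>2 > 0"
      using assms by (intro add_pos_nonneg) auto
    then show ?thesis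
      by simp
  qed
  have "has_bochner_integral lborel (\<lambda>\<psi>. ?g \<psi> * indicator {0..pi} \<psi>) (G pi - G 0)"
  proof (rule has_bochner_integral_FTC_Icc_real)
    show "DERIV G \<psi> :> ?g \<psi>" for \<psi>
      unfolding G_def P_def W_def R_def
      by (rule has_real_derivative_angular_antiderivative[OF assms])
    show "isCont ?g \<psi>" for \<psi>
      using nz by (intro continuous_intros) auto
  qed simp
  moreover have "G pi - G 0 = 2 * pi\<^sup>2 * poisson_kernel \<alpha> z"
  proof -
    \<comment> \<open>Sine and cosine both change sign under a half turn, so their quadratic expressions agree.\<close>
    have "P pi = P 0" "W pi = W 0"
      by (simp_all add: P_def W_def sin_diff cos_diff)
    then have "G pi - G 0 = \<alpha> / R ^ 3 * pi"
      by (simp add: G_def algebra_simps add_divide_distrib)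
    then show ?thesis
      by (simp add: poisson_kernel_def R_def r_def power2_eq_square)
  qed
  ultimately have "has_bochner_integral lborel (\<lambda>\<psi>. ?g \<psi> * indicator {0..pi} \<psi>) (2 * pi\<^sup>2 * poisson_kernel \<alpha> z)"
    by simp
  moreover have "AE \<psi> in lborel. ?g \<psi> * indicator {0..pi} \<psi> = ?g \<psi> * indicator {0..<pi} \<psi>"
    using AE_lborel_singleton[of pi] by eventually_elim (auto simp: indicator_def)
  ultimately show ?thesis
    unfolding proj power_mult_distrib
    by (subst has_bochner_integral_cong_AE[symmetric]) simp_all
qed

section \<open>The operator as a convolution\<close>

lemma abs_Phi_le:
  assumes "\<alpha> > 0"
  shows "\<bar>Phi \<alpha> x t \<psi>\<bar> \<le> 1 / \<alpha>\<^sup>2"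
proof -
  define s where "s = (fst x * cos \<psi> + snd x * sin \<psi> - t)\<^sup>2"
  define a where "a = \<alpha>\<^sup>2"
  have a: "a > 0" and s: "s \<ge> 0"
    using assms by (auto simp: a_def s_def)
  have "\<bar>(a - s) / (a + s)\<^sup>2\<bar> \<le> (a + s) / (a + s)\<^sup>2"
    using a s by (simp add: abs_divide divide_right_mono abs_le_iff)
  also have "\<dots> = 1 / (a + s)"
    using a s by (simp add: power2_eq_square)
  also have "\<dots> \<le> 1 / a"
    using a s by (simp add: field_simps)
  finally have "\<bar>(a - s) / (a + s)\<^sup>2\<bar> \<le> 1 / a" .
  moreover have "\<bar>1 / (2 * pi\<^sup>2)\<bar> \<le> 1"
  proof -
    have "1 \<le> pi\<^sup>2"
      using pi_gt3 by (simp add: one_le_power)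
    then show ?thesis
      by simp
  qed
  ultimately have "\<bar>1 / (2 * pi\<^sup>2)\<bar> * \<bar>(a - s) / (a + s)\<^sup>2\<bar> \<le> 1 * (1 / a)"
    by (intro mult_mono) auto
  then show ?thesis
    unfolding Phi_def abs_mult a_def s_def by simp
qed

lemma borel_measurable_Phi [measurable (raw)]:
  assumes [measurable]: "t \<in> borel_measurable M" "\<psi> \<in> borel_measurable M"
  shows "(\<lambda>z. Phi \<alpha> x (t z) (\<psi> z)) \<in> borel_measurable M"
  unfolding Phi_def by measurable

lemma integrable_Phi_times:
  fixes f :: "'a \<Rightarrow> complex"
  assumes "\<alpha> > 0" "integrable M f"
    and [measurable]: "t \<in> borel_measurable M" "\<psi> \<in> borel_measurable M"
  shows "integrable M (\<lambda>z. complex_of_real (Phi \<alpha> x (t z) (\<psi> z)) * f z)"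
proof (rule Bochner_Integration.integrable_bound)
  show "integrable M (\<lambda>z. complex_of_real (1 / \<alpha>\<^sup>2) * f z)"
    using assms by simp
  show "(\<lambda>z. complex_of_real (Phi \<alpha> x (t z) (\<psi> z)) * f z) \<in> borel_measurable M"
    using borel_measurable_integrable[OF assms(2)] by measurable
  show "AE z in M. norm (complex_of_real (Phi \<alpha> x (t z) (\<psi> z)) * f z) \<le> norm (complex_of_real (1 / \<alpha>\<^sup>2) * f z)"
  proof (rule AE_I2)
    fix z
    have "\<bar>Phi \<alpha> x (t z) (\<psi> z)\<bar> \<le> \<bar>1 / \<alpha>\<^sup>2\<bar>"
      using abs_Phi_le[OF assms(1)] by simp
    then show "norm (complex_of_real (Phi \<alpha> x (t z) (\<psi> z)) * f z) \<le> norm (complex_of_real (1 / \<alpha>\<^sup>2) * f z)"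
      unfolding norm_mult norm_of_real by (rule mult_right_mono) simp
  qed
qed

text \<open>
  After the substitution \<open>y = rotation \<psi> (t, u)\<close> the coordinate \<open>t\<close> is the inner product of \<open>y\<close> with
  \<open>(cos \<psi>, sin \<psi>)\<close>.
\<close>

lemma integral_Phi_radon:
  fixes f :: "real \<times> real \<Rightarrow> complex"
  assumes "\<alpha> > 0" and f: "integrable lborel f" and \<psi>: "0 \<le> \<psi>" "\<psi> < pi"
  shows "(LINT t|lebesgue. complex_of_real (Phi \<alpha> x t \<psi>) * radon f t \<psi>)
       = (LINT y|lborel. complex_of_real (Phi \<alpha> x (fst y * cos \<psi> + snd y * sin \<psi>) \<psi>) * f y)"
proof -
  have fm [measurable]: "f \<in> borel_measurable borel"
    using f by (simp add: borel_measurable_integrable)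
  let ?g = "\<lambda>z. complex_of_real (Phi \<alpha> x (fst z) \<psi>) * f (rotation \<psi> z)"
  have [measurable]: "(\<lambda>z. f (rotation \<psi> z)) \<in> borel_measurable (lborel \<Otimes>\<^sub>M lborel)"
    by (simp add: lborel_prod)
  have line: "radon f t \<psi> = (LINT u|lborel. f (rotation \<psi> (t, u)))" for t
    unfolding radon_def rotation_def fst_conv snd_conv
    by (rule integral_completion) measurable
  have rot: "integrable lborel (\<lambda>z. f (rotation \<psi> z))"
    using f distr_lborel_rotation[OF \<psi>] integrable_distr_eq[of "rotation \<psi>" lborel lborel f] by simp
  have g: "integrable lborel ?g"
    using integrable_Phi_times[OF assms(1) rot, of fst "\<lambda>_. \<psi>" x]
    by (simp add: borel_measurable_continuous_onI continuous_on_fst)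
  have meas: "(\<lambda>t. complex_of_real (Phi \<alpha> x t \<psi>) * (LINT u|lborel. f (rotation \<psi> (t, u)))) \<in> borel_measurable lborel"
    by measurable
  have "(LINT t|lebesgue. complex_of_real (Phi \<alpha> x t \<psi>) * radon f t \<psi>)
      = (LINT t|lborel. (LINT u|lborel. ?g (t, u)))"
    unfolding line integral_completion[OF meas] by simp
  also have "\<dots> = integral\<^sup>L lborel ?g"
    using lborel_pair.integral_fst[of "\<lambda>t u. ?g (t, u)"] g by (simp add: lborel_prod split_beta')
  also have "\<dots> = (LINT z|lborel. complex_of_real
      (Phi \<alpha> x (fst (rotation \<psi> z) * cos \<psi> + snd (rotation \<psi> z) * sin \<psi>) \<psi>) * f (rotation \<psi> z))"
  proof (rule Bochner_Integration.integral_cong[OF refl])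
    fix z :: "real \<times> real"
    have "fst (rotation \<psi> z) * cos \<psi> + snd (rotation \<psi> z) * sin \<psi> = fst z * ((cos \<psi>)\<^sup>2 + (sin \<psi>)\<^sup>2)"
      unfolding rotation_def fst_conv snd_conv by algebra
    then show "?g z = complex_of_real
      (Phi \<alpha> x (fst (rotation \<psi> z) * cos \<psi> + snd (rotation \<psi> z) * sin \<psi>) \<psi>) * f (rotation \<psi> z)"
      by simp
  qed
  also have "\<dots> = (LINT y|distr lborel lborel (rotation \<psi>).
      complex_of_real (Phi \<alpha> x (fst y * cos \<psi> + snd y * sin \<psi>) \<psi>) * f y)"
    using borel_measurable_integrable[OF integrable_Phi_times[OF assms(1) f,
          of "\<lambda>y. fst y * cos \<psi> + snd y * sin \<psi>" "\<lambda>_. \<psi>" x]]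
    by (subst integral_distr)
       (simp_all add: borel_measurable_continuous_onI continuous_intros)
  finally show ?thesis
    unfolding distr_lborel_rotation[OF \<psi>] .
qed

text \<open>
  The direction ranges over a set of finite measure and \<^const>\<open>Phi\<close> is bounded, so the order of integration
  over \<open>\<psi>\<close> and \<open>y\<close> may be exchanged.
\<close>

theorem A_op_eq_poisson_convolution:
  fixes f :: "real \<times> real \<Rightarrow> complex"
  assumes "\<alpha> > 0" and f: "integrable lborel f"
  shows "A_op \<alpha> f x = (LINT y|lborel. complex_of_real (poisson_kernel \<alpha> (x - y)) * f y)"
proof -
  have fm [measurable]: "f \<in> borel_measurable borel"
    using f by (simp add: borel_measurable_integrable)
  \<comment> \<open>The indicator is attached to \<open>f\<close>, so that the product is an integrable function times a bounded one.\<close>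
  let ?h = "\<lambda>\<psi> y. complex_of_real (Phi \<alpha> x (fst y * cos \<psi> + snd y * sin \<psi>) \<psi>)
              * (indicator {0..<pi} \<psi> * f y)"
  have [measurable]: "f \<in> borel_measurable (lborel \<Otimes>\<^sub>M lborel)"
    by (simp add: lborel_prod)
  have "integrable (lborel \<Otimes>\<^sub>M lborel) (\<lambda>(\<psi>::real, y). indicator {0..<pi} \<psi> * f y)"
  proof (rule lborel_pair.Fubini_integrable)
    show "(\<lambda>(\<psi>::real, y). indicator {0..<pi} \<psi> * f y) \<in> borel_measurable (lborel \<Otimes>\<^sub>M lborel)"
      by measurable
    show "integrable lborel (\<lambda>\<psi>::real. LINT y|lborel. norm (case (\<psi>, y) of (\<psi>, y) \<Rightarrow> indicator {0..<pi} \<psi> * f y))"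
    proof -
      have "(\<lambda>\<psi>. cmod (indicator {0..<pi} \<psi>)) = indicator {0..<pi}"
        by (auto simp: indicator_def)
      moreover have "integrable lborel (indicator {0..<pi} :: real \<Rightarrow> real)"
        by simp
      ultimately show ?thesis
        by (simp add: norm_mult)
    qed
    show "AE \<psi>::real in lborel. integrable lborel (\<lambda>y. case (\<psi>, y) of (\<psi>, y) \<Rightarrow> indicator {0..<pi} \<psi> * f y)"
      using f by simp
  qed
  moreover have "(\<lambda>z :: real \<times> real \<times> real. fst (snd z) * cos (fst z) + snd (snd z) * sin (fst z))
      \<in> borel_measurable (lborel \<Otimes>\<^sub>M lborel)"
    unfolding lborel_prod measurable_lborel2
    by (intro borel_measurable_continuous_onI continuous_intros)
  ultimately have h: "integrable (lborel \<Otimes>\<^sub>M lborel) (\<lambda>(\<psi>, y). ?h \<psi> y)"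
    using integrable_Phi_times[OF assms(1), of "lborel \<Otimes>\<^sub>M lborel"
        "\<lambda>(\<psi>::real, y). indicator {0..<pi} \<psi> * f y"
        "\<lambda>z. fst (snd z) * cos (fst z) + snd (snd z) * sin (fst z)" fst x]
    by (simp add: split_beta')
  have meas: "(\<lambda>\<psi>. LINT y|lborel. ?h \<psi> y) \<in> borel_measurable lborel"
    using lborel.borel_measurable_lebesgue_integral[OF borel_measurable_integrable[OF h]] by simp
  have "A_op \<alpha> f x = (LINT \<psi>|lebesgue. (LINT y|lborel. ?h \<psi> y))"
    unfolding A_op_def set_lebesgue_integral_def
    by (intro Bochner_Integration.integral_cong refl)
       (auto simp: indicator_def integral_Phi_radon[OF assms])
  also have "\<dots> = (LINT \<psi>|lborel. (LINT y|lborel. ?h \<psi> y))"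
    by (rule integral_completion[OF meas])
  also have "\<dots> = (LINT y|lborel. (LINT \<psi>|lborel. ?h \<psi> y))"
    by (rule lborel_pair.Fubini_integral[OF h, symmetric])
  also have "\<dots> = (LINT y|lborel. complex_of_real (poisson_kernel \<alpha> (x - y)) * f y)"
  proof (rule Bochner_Integration.integral_cong[OF refl])
    fix y :: "real \<times> real"
    let ?G = "\<lambda>\<psi>. (\<alpha>\<^sup>2 - (fst (x - y) * cos \<psi> + snd (x - y) * sin \<psi>)\<^sup>2)
        / (\<alpha>\<^sup>2 + (fst (x - y) * cos \<psi> + snd (x - y) * sin \<psi>)\<^sup>2)\<^sup>2 * indicator {0..<pi} \<psi>"
    have "?h \<psi> y = complex_of_real (1 / (2 * pi\<^sup>2) * ?G \<psi>) * f y" for \<psi>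
      by (simp add: Phi_def algebra_simps indicator_def)
    then have "(LINT \<psi>|lborel. ?h \<psi> y) = complex_of_real (1 / (2 * pi\<^sup>2) * (LINT \<psi>|lborel. ?G \<psi>)) * f y"
      by (simp only: integral_mult_left_zero integral_mult_right_zero integral_complex_of_real)
    also have "(LINT \<psi>|lborel. ?G \<psi>) = 2 * pi\<^sup>2 * poisson_kernel \<alpha> (x - y)"
      by (rule has_bochner_integral_integral_eq[OF has_bochner_integral_angular[OF assms(1)]])
    finally show "(LINT \<psi>|lborel. ?h \<psi> y) = complex_of_real (poisson_kernel \<alpha> (x - y)) * f y"
      by simp
  qed
  finally show ?thesis .
qed

section \<open>The Poisson kernels as an approximate identity\<close>

lemma has_bochner_integral_FTC_real_line:
  fixes f F :: "real \<Rightarrow> real"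
  assumes "\<And>x. DERIV F x :> f x" "\<And>x. isCont f x" "\<And>x. 0 \<le> f x"
    and "(F \<longlongrightarrow> A) at_bot" "(F \<longlongrightarrow> B) at_top"
  shows "has_bochner_integral lborel f (B - A)"
proof -
  have lim: "((F \<circ> real_of_ereal) \<longlongrightarrow> A) (at_right (-\<infinity>))" "((F \<circ> real_of_ereal) \<longlongrightarrow> B) (at_left \<infinity>)"
    using assms(4,5) by (simp_all add: ereal_tendsto_simps)
  note FTC = interval_integral_FTC_nonneg[of "-\<infinity>" "\<infinity>" F f A B, OF _ assms(1,2) _ lim]
  have "integrable lborel f"
    using FTC(1) assms(3) by (simp add: set_integrable_def einterval_def)
  moreover have "integral\<^sup>L lborel f = B - A"
    using FTC(2) assms(3)
    by (simp add: interval_lebesgue_integral_def set_lebesgue_integral_def einterval_def)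
  ultimately show ?thesis
    by (simp add: has_bochner_integral_iff)
qed

lemma tendsto_arctan_divide:
  fixes a :: real
  assumes "a > 0"
  shows "((\<lambda>x. arctan (x / a)) \<longlongrightarrow> pi / 2) at_top"
    and "((\<lambda>x. arctan (x / a)) \<longlongrightarrow> - (pi / 2)) at_bot"
proof -
  have *: "x / a = inverse a * x" for x
    by (simp add: divide_inverse)
  have "filterlim (\<lambda>x. x / a) at_top at_top"
    unfolding * by (rule filterlim_tendsto_pos_mult_at_top[OF tendsto_const _ filterlim_ident]) (use assms in simp)
  then show "((\<lambda>x. arctan (x / a)) \<longlongrightarrow> pi / 2) at_top"
    by (rule filterlim_compose[OF tendsto_arctan_at_top])
  have "filterlim (\<lambda>x. x / a) at_bot at_bot"
    unfolding * by (rule filterlim_tendsto_pos_mult_at_bot[OF tendsto_const _ filterlim_ident]) (use assms in simp)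
  then show "((\<lambda>x. arctan (x / a)) \<longlongrightarrow> - (pi / 2)) at_bot"
    by (rule filterlim_compose[OF tendsto_arctan_at_bot])
qed

lemma has_bochner_integral_inverse_sqrt_cubed:
  fixes a :: real
  assumes "a > 0"
  shows "has_bochner_integral lborel (\<lambda>x. 1 / sqrt (a\<^sup>2 + x\<^sup>2) ^ 3) (2 / a\<^sup>2)"
proof -
  \<comment> \<open>This is \<open>x / (a\<^sup>2 sqrt (a\<^sup>2 + x\<^sup>2))\<close>, in a form whose limits at infinity are immediate.\<close>
  define F where "F = (\<lambda>x. sin (arctan (x / a)) / a\<^sup>2)"
  have pos: "a\<^sup>2 + x\<^sup>2 > 0" for x
    using assms by (auto intro: add_pos_nonneg)
  note lim = tendsto_arctan_divide[OF assms]
  have "has_bochner_integral lborel (\<lambda>x. 1 / sqrt (a\<^sup>2 + x\<^sup>2) ^ 3) (1 / a\<^sup>2 - (- 1 / a\<^sup>2))"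
  proof (rule has_bochner_integral_FTC_real_line[of F])
    fix x :: real
    define s where "s = sqrt (a\<^sup>2 + x\<^sup>2)"
    have s: "s > 0" "s\<^sup>2 = a\<^sup>2 + x\<^sup>2"
      using pos[of x] by (auto simp: s_def)
    have eq: "1 + (x / a)\<^sup>2 = (s / a)\<^sup>2"
      unfolding power_divide s(2) using assms by (simp add: field_simps)
    have "DERIV F x :> cos (arctan (x / a)) * (inverse (1 + (x / a)\<^sup>2) * (1 / a)) / a\<^sup>2"
      unfolding F_def
      by (rule DERIV_cdivide DERIV_chain2[OF DERIV_sin] DERIV_chain2[OF DERIV_arctan] DERIV_ident)+
    moreover have "cos (arctan (x / a)) * (inverse (1 + (x / a)\<^sup>2) * (1 / a)) / a\<^sup>2 = 1 / s ^ 3"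
      unfolding cos_arctan eq real_sqrt_abs using assms s(1)
      by (simp add: field_simps power2_eq_square power3_eq_cube)
    ultimately show "DERIV F x :> 1 / sqrt (a\<^sup>2 + x\<^sup>2) ^ 3"
      by (simp add: s_def)
    show "isCont (\<lambda>x. 1 / sqrt (a\<^sup>2 + x\<^sup>2) ^ 3) x"
      using pos[of x] by (intro continuous_intros) auto
    show "0 \<le> 1 / sqrt (a\<^sup>2 + x\<^sup>2) ^ 3"
      by simp
  next
    have "(F \<longlongrightarrow> sin (- (pi / 2)) / a\<^sup>2) at_bot"
      unfolding F_def using assms by (intro tendsto_intros lim) simp
    then show "(F \<longlongrightarrow> - 1 / a\<^sup>2) at_bot"
      by simp
    have "(F \<longlongrightarrow> sin (pi / 2) / a\<^sup>2) at_top"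
      unfolding F_def using assms by (intro tendsto_intros lim) simp
    then show "(F \<longlongrightarrow> 1 / a\<^sup>2) at_top"
      by simp
  qed
  then show ?thesis
    by simp
qed

lemma has_bochner_integral_inverse_sum_squares:
  fixes a :: real
  assumes "a > 0"
  shows "has_bochner_integral lborel (\<lambda>x. 1 / (a\<^sup>2 + x\<^sup>2)) (pi / a)"
proof -
  define F where "F = (\<lambda>x. arctan (x / a) / a)"
  have pos: "a\<^sup>2 + x\<^sup>2 > 0" for x
    using assms by (auto intro: add_pos_nonneg)
  note lim = tendsto_arctan_divide[OF assms]
  have "has_bochner_integral lborel (\<lambda>x. 1 / (a\<^sup>2 + x\<^sup>2)) (pi / 2 / a - (- (pi / 2) / a))"
  proof (rule has_bochner_integral_FTC_real_line[of F])
    fix x :: real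
    have "DERIV F x :> inverse (1 + (x / a)\<^sup>2) * (1 / a) / a"
      unfolding F_def by (rule DERIV_cdivide DERIV_chain2[OF DERIV_arctan] DERIV_ident)+
    moreover have "inverse (1 + (x / a)\<^sup>2) * (1 / a) / a = 1 / (a\<^sup>2 + x\<^sup>2)"
    proof -
      have "1 + (x / a)\<^sup>2 = (a\<^sup>2 + x\<^sup>2) / a\<^sup>2"
        using assms by (simp add: power_divide add_divide_distrib)
      then show ?thesis
        using assms by (simp add: power2_eq_square)
    qed
    ultimately show "DERIV F x :> 1 / (a\<^sup>2 + x\<^sup>2)"
      by simp
    show "isCont (\<lambda>x. 1 / (a\<^sup>2 + x\<^sup>2)) x"
      using pos[of x] by (intro continuous_intros) auto
    show "0 \<le> 1 / (a\<^sup>2 + x\<^sup>2)"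
      by simp
  next
    show "(F \<longlongrightarrow> - (pi / 2) / a) at_bot"
      unfolding F_def by (rule tendsto_divide[OF lim(2) tendsto_const]) (use assms in simp)
    show "(F \<longlongrightarrow> pi / 2 / a) at_top"
      unfolding F_def by (rule tendsto_divide[OF lim(1) tendsto_const]) (use assms in simp)
  qed
  then show ?thesis
    by simp
qed

lemma poisson_nonneg: "\<alpha> > 0 \<Longrightarrow> 0 \<le> poisson_kernel \<alpha> y"
  by (simp add: poisson_kernel_def)

text \<open>
  Integrating out one coordinate leaves the one-dimensional Cauchy density \<open>\<alpha> / (\<pi> (\<alpha>\<^sup>2 + x\<^sup>2))\<close>.
\<close>

lemma has_bochner_integral_poisson:
  assumes "\<alpha> > 0"
  shows "has_bochner_integral lborel (poisson_kernel \<alpha>) 1"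
proof -
  have inner: "(\<integral>\<^sup>+y. ennreal (poisson_kernel \<alpha> (x, y)) \<partial>lborel) = ennreal (\<alpha> / pi * (1 / (\<alpha>\<^sup>2 + x\<^sup>2)))" for x
  proof -
    define a where "a = sqrt (\<alpha>\<^sup>2 + x\<^sup>2)"
    have a: "a > 0" "a\<^sup>2 = \<alpha>\<^sup>2 + x\<^sup>2"
      using assms by (auto simp: a_def add_pos_nonneg)
    have p: "poisson_kernel \<alpha> (x, y) = \<alpha> / (2 * pi) * (1 / sqrt (a\<^sup>2 + y\<^sup>2) ^ 3)" for y
      by (simp add: poisson_kernel_def norm_Pair a(2) add.assoc)
    have "has_bochner_integral lborel (\<lambda>y. poisson_kernel \<alpha> (x, y)) (\<alpha> / (2 * pi) * (2 / a\<^sup>2))"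
      unfolding p
      by (rule has_bochner_integral_mult_right[OF has_bochner_integral_inverse_sqrt_cubed[OF a(1)]])
    then have "(\<integral>\<^sup>+y. ennreal (poisson_kernel \<alpha> (x, y)) \<partial>lborel) = ennreal (\<alpha> / (2 * pi) * (2 / a\<^sup>2))"
      using poisson_nonneg[OF assms] by (simp add: has_bochner_integral_iff nn_integral_eq_integral)
    then show ?thesis
      by (simp add: a(2))
  qed
  have outer: "has_bochner_integral lborel (\<lambda>x. \<alpha> / pi * (1 / (\<alpha>\<^sup>2 + x\<^sup>2))) (\<alpha> / pi * (pi / \<alpha>))"
    by (rule has_bochner_integral_mult_right[OF has_bochner_integral_inverse_sum_squares[OF assms]])
  have meas: "(\<lambda>z. ennreal (poisson_kernel \<alpha> z)) \<in> borel_measurable (lborel \<Otimes>\<^sub>M lborel)"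
    unfolding lborel_prod by measurable
  have "(\<integral>\<^sup>+z. ennreal (poisson_kernel \<alpha> z) \<partial>lborel)
      = (\<integral>\<^sup>+x. (\<integral>\<^sup>+y. ennreal (poisson_kernel \<alpha> (x, y)) \<partial>lborel) \<partial>lborel)"
    using lborel.nn_integral_fst[OF meas] by (simp add: lborel_prod)
  also have "\<dots> = ennreal (\<alpha> / pi * (pi / \<alpha>))"
    unfolding inner using outer assms
    by (subst nn_integral_eq_integral) (auto simp: has_bochner_integral_iff)
  also have "\<dots> = ennreal 1"
    using assms by simp
  finally show ?thesis
    by (intro has_bochner_integral_nn_integral) (auto simp: poisson_nonneg[OF assms])
qed

lemma has_bochner_integral_poisson_translate:
  assumes "\<alpha> > 0"
  shows "has_bochner_integral lborel (\<lambda>y. poisson_kernel \<alpha> (x - y)) 1"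
proof -
  have "has_bochner_integral (distr lborel borel ((+) (- x))) (poisson_kernel \<alpha>) 1"
    unfolding lborel_distr_plus by (rule has_bochner_integral_poisson[OF assms])
  then have "has_bochner_integral lborel (\<lambda>y. poisson_kernel \<alpha> (- x + y)) 1"
    unfolding has_bochner_integral_iff
    by (subst (asm) integrable_distr_eq, measurable, subst (asm) integral_distr, measurable)
  moreover have "(\<lambda>y. poisson_kernel \<alpha> (- x + y)) = (\<lambda>y. poisson_kernel \<alpha> (x - y))"
  proof
    fix y
    have "norm (- x + y) = norm (x - y)"
      using norm_minus_commute[of x y] by simp
    then show "poisson_kernel \<alpha> (- x + y) = poisson_kernel \<alpha> (x - y)"
      by (simp only: poisson_kernel_def)
  qed
  ultimately show ?thesis
    by (simp only:)
qed

text \<open>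
  Away from the origin \<open>\<alpha>\<^sup>2 + |y|\<^sup>2\<close> and \<open>1 + |y|\<^sup>2\<close> are comparable, which isolates the factor \<open>\<alpha>\<close>.
  Comparing with the kernel \<open>P\<^sub>1\<close> gives a bound that is integrable as well as uniform: the first
  controls the tail of the constant \<open>f(x)\<close>, the second that of the integrable function \<open>f\<close>.
\<close>

lemma poisson_le_scaled_poisson_1:
  assumes "\<alpha> > 0" "d > 0" "d \<le> norm y"
  shows "poisson_kernel \<alpha> y \<le> \<alpha> * sqrt (1 + 1 / d\<^sup>2) ^ 3 * poisson_kernel 1 y"
proof -
  define n where "n = (norm y)\<^sup>2"
  have "d\<^sup>2 \<le> n"
    unfolding n_def using assms by (intro power_mono) auto
  then have "1 + n \<le> n / d\<^sup>2 + n"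
    using assms by simp
  also have "\<dots> = (1 + 1 / d\<^sup>2) * n"
    by (simp add: algebra_simps)
  also have "\<dots> \<le> (1 + 1 / d\<^sup>2) * (\<alpha>\<^sup>2 + n)"
    by (intro mult_left_mono) auto
  finally have "sqrt (1 + n) \<le> sqrt (1 + 1 / d\<^sup>2) * sqrt (\<alpha>\<^sup>2 + n)"
    unfolding real_sqrt_mult[symmetric] by (rule real_sqrt_le_mono)
  then have "sqrt (1 + n) ^ 3 \<le> sqrt (1 + 1 / d\<^sup>2) ^ 3 * sqrt (\<alpha>\<^sup>2 + n) ^ 3"
    unfolding power_mult_distrib[symmetric] by (intro power_mono) (auto simp: n_def)
  moreover have "sqrt (1 + n) ^ 3 > 0" "sqrt (\<alpha>\<^sup>2 + n) ^ 3 > 0"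
    using assms by (auto simp: n_def add_pos_nonneg)
  ultimately have "1 / sqrt (\<alpha>\<^sup>2 + n) ^ 3 \<le> sqrt (1 + 1 / d\<^sup>2) ^ 3 / sqrt (1 + n) ^ 3"
    by (simp only: pos_le_divide_eq pos_divide_le_eq times_divide_eq_left mult_1_left)
  then have "\<alpha> / (2 * pi) * (1 / sqrt (\<alpha>\<^sup>2 + n) ^ 3)
      \<le> \<alpha> / (2 * pi) * (sqrt (1 + 1 / d\<^sup>2) ^ 3 / sqrt (1 + n) ^ 3)"
    using assms by (intro mult_left_mono) auto
  then show ?thesis
    by (simp add: poisson_kernel_def n_def)
qed

lemma poisson_1_le_1: "poisson_kernel 1 y \<le> 1"
proof -
  have "1 \<le> sqrt (1 + (norm y)\<^sup>2) ^ 3"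
    by (intro one_le_power) simp
  then have "1 * 1 \<le> 2 * pi * sqrt (1 + (norm y)\<^sup>2) ^ 3"
    using pi_gt3 by (intro mult_mono) auto
  then show ?thesis
    by (simp add: poisson_kernel_def)
qed

text \<open>
  The point \<open>y\<close> is not confined to \<open>K\<close>; uniform continuity is therefore applied on a closed neighbourhood
  of \<open>K\<close>, which is the sum of \<open>K\<close> with a closed ball and hence compact.
\<close>

lemma uniform_modulus_near_compact:
  fixes f :: "'a::euclidean_space \<Rightarrow> 'b::metric_space"
  assumes "compact K" "open \<Omega>" "K \<subseteq> \<Omega>" "continuous_on \<Omega> f" "e > 0"
  shows "\<exists>d>0. \<forall>x\<in>K. \<forall>y. dist x y < d \<longrightarrow> dist (f y) (f x) < e"
proof -
  obtain r where r: "r > 0" "(\<Union>x\<in>K. cball x r) \<subseteq> \<Omega>"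
    using compact_subset_open_imp_cball_epsilon_subset[OF assms(1-3)] .
  have "(\<Union>x\<in>K. cball x r) = {x + y |x y. x \<in> K \<and> y \<in> cball 0 r}"
  proof (intro equalityI subsetI)
    fix z assume "z \<in> (\<Union>x\<in>K. cball x r)"
    then obtain x where "x \<in> K" "dist x z \<le> r" by auto
    then have "z = x + (z - x)" "z - x \<in> cball 0 r" by (auto simp: dist_norm norm_minus_commute)
    with \<open>x \<in> K\<close> show "z \<in> {x + y |x y. x \<in> K \<and> y \<in> cball 0 r}" by blast
  next
    fix z assume "z \<in> {x + y |x y. x \<in> K \<and> y \<in> cball 0 r}"
    then obtain x y where "z = x + y" "x \<in> K" "norm y \<le> r" by auto
    then have "z \<in> cball x r" by (simp add: dist_norm)
    with \<open>x \<in> K\<close> show "z \<in> (\<Union>x\<in>K. cball x r)" by blast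
  qed
  then have "compact (\<Union>x\<in>K. cball x r)"
    using compact_sums[OF assms(1) compact_cball[of 0 r]] by simp
  then have "uniformly_continuous_on (\<Union>x\<in>K. cball x r) f"
    using compact_uniformly_continuous continuous_on_subset[OF assms(4) r(2)] by blast
  then obtain d where d: "d > 0"
    "\<forall>x\<in>(\<Union>x\<in>K. cball x r). \<forall>y\<in>(\<Union>x\<in>K. cball x r). dist y x < d \<longrightarrow> dist (f y) (f x) < e"
    unfolding uniformly_continuous_on_def using assms(5) by blast
  have "dist (f y) (f x) < e" if "x \<in> K" "dist x y < min d r" for x y
  proof -
    have "x \<in> cball x r" "y \<in> cball x r" "dist y x < d"
      using that(2) r(1) by (auto simp: dist_commute)
    then show ?thesis
      using d(2) that(1) by blast
  qed
  then show ?thesis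
    using d(1) r(1) by (intro exI[of _ "min d r"]) simp
qed

text \<open>
  Since the kernel has integral 1, the error is the integral of \<open>P\<^sub>\<alpha>(x - y) (f(y) - f(x))\<close>. The integrand
  has a single bound valid both near and far from \<open>x\<close>, whose integral is
  \<open>e / 2\<close> plus a constant times \<open>\<alpha>\<close>.
\<close>

theorem uniform_limit_poisson_convolution:
  fixes f :: "real \<times> real \<Rightarrow> complex"
  assumes f: "integrable lborel f" and "open \<Omega>" "continuous_on \<Omega> f" "compact K" "K \<subseteq> \<Omega>"
  shows "uniform_limit K (\<lambda>\<alpha> x. LINT y|lborel. complex_of_real (poisson_kernel \<alpha> (x - y)) * f y) f (at_right 0)"
proof (rule uniform_limitI)
  fix e :: real assume "e > 0"
  obtain d where d: "d > 0" "\<forall>x\<in>K. \<forall>y. dist x y < d \<longrightarrow> dist (f y) (f x) < e / 2"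
    using uniform_modulus_near_compact[OF assms(4,2,5,3) half_gt_zero[OF \<open>e > 0\<close>]] by blast
  have "bounded (f ` K)"
    by (rule compact_imp_bounded[OF compact_continuous_image[OF continuous_on_subset[OF assms(3,5)] assms(4)]])
  then obtain B where B: "B > 0" "\<forall>x\<in>K. norm (f x) \<le> B"
    unfolding bounded_pos by blast
  define C where "C = sqrt (1 + 1 / d\<^sup>2) ^ 3"
  have C: "C \<ge> 0"
    by (simp add: C_def)
  define N where "N = (LINT y|lborel. norm (f y))"
  have "((\<lambda>\<alpha>. e / 2 + \<alpha> * C * (N + B)) \<longlongrightarrow> e / 2 + 0 * C * (N + B)) (at_right 0)"
    by (intro tendsto_intros)
  then have "\<forall>\<^sub>F \<alpha> in at_right 0. e / 2 + \<alpha> * C * (N + B) < e"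
    by (rule order_tendstoD) (use \<open>e > 0\<close> in simp)
  then show "\<forall>\<^sub>F \<alpha> in at_right 0. \<forall>x\<in>K.
      dist (LINT y|lborel. complex_of_real (poisson_kernel \<alpha> (x - y)) * f y) (f x) < e"
    using eventually_at_right_less[of 0]
  proof eventually_elim
    case (elim \<alpha>)
    then have \<alpha>: "\<alpha> > 0" by simp
    show ?case
    proof
      fix x assume x: "x \<in> K"
      let ?P = "\<lambda>\<alpha> y. poisson_kernel \<alpha> (x - y)"
      have P: "integrable lborel (?P \<beta>)" "integral\<^sup>L lborel (?P \<beta>) = 1" if "\<beta> > 0" for \<beta>
        using has_bochner_integral_poisson_translate[OF that, of x] by (auto simp: has_bochner_integral_iff)
      let ?g = "\<lambda>y. e / 2 * ?P \<alpha> y + \<alpha> * C * (norm (f y) + B * ?P 1 y)"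
      have bound: "norm (complex_of_real (?P \<alpha> y) * (f y - f x)) \<le> ?g y" for y
      proof -
        have eq: "norm (complex_of_real (?P \<alpha> y) * (f y - f x)) = ?P \<alpha> y * dist (f y) (f x)"
          using poisson_nonneg[OF \<alpha>, of "x - y"] by (simp add: norm_mult dist_norm)
        have near: "0 \<le> e / 2 * ?P \<alpha> y"
          using \<open>e > 0\<close> poisson_nonneg[OF \<alpha>] by simp
        have far: "0 \<le> \<alpha> * C * (norm (f y) + B * ?P 1 y)"
          using \<alpha> C B(1) poisson_nonneg[of 1 "x - y"] by simp
        show ?thesis
        proof (cases "dist x y < d")
          case True
          then have "dist (f y) (f x) \<le> e / 2"
            using d(2) x by (blast intro: less_imp_le)
          then have "dist (f y) (f x) * ?P \<alpha> y \<le> e / 2 * ?P \<alpha> y"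
            by (rule mult_right_mono[OF _ poisson_nonneg[OF \<alpha>]])
          then show ?thesis
            unfolding eq mult.commute[of "?P \<alpha> y" "dist _ _"] using far by linarith
        next
          case False
          then have "?P \<alpha> y \<le> \<alpha> * C * ?P 1 y"
            unfolding C_def using \<alpha> d(1) by (intro poisson_le_scaled_poisson_1) (auto simp: dist_norm)
          moreover have "dist (f y) (f x) \<le> norm (f y) + B"
            using norm_triangle_ineq4[of "f y" "f x"] bspec[OF B(2) x] unfolding dist_norm by linarith
          ultimately have "?P \<alpha> y * dist (f y) (f x) \<le> \<alpha> * C * ?P 1 y * (norm (f y) + B)"
            using \<alpha> C poisson_nonneg[of 1 "x - y"] by (intro mult_mono) auto
          also have "\<dots> = \<alpha> * C * (?P 1 y * norm (f y) + B * ?P 1 y)"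
            by (simp add: algebra_simps)
          also have "\<dots> \<le> \<alpha> * C * (norm (f y) + B * ?P 1 y)"
          proof (intro mult_left_mono add_right_mono mult_left_le_one_le)
            show "0 \<le> \<alpha> * C"
              using \<alpha> C by simp
          qed (simp_all add: poisson_nonneg poisson_1_le_1)
          finally show ?thesis
            unfolding eq using near by linarith
        qed
      qed
      have g: "integrable lborel ?g" "integral\<^sup>L lborel ?g = e / 2 + \<alpha> * C * (N + B)"
        using f P[OF \<alpha>] P[of 1] by (simp_all add: N_def)
      have Pf: "integrable lborel (\<lambda>y. complex_of_real (?P \<alpha> y) * (f y - f x))"
      proof (rule Bochner_Integration.integrable_bound[OF g(1)])
        show "(\<lambda>y. complex_of_real (?P \<alpha> y) * (f y - f x)) \<in> borel_measurable lborel"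
          using borel_measurable_integrable[OF f] by measurable
        show "AE y in lborel. norm (complex_of_real (?P \<alpha> y) * (f y - f x)) \<le> norm (?g y)"
          using order_trans[OF bound abs_ge_self] unfolding real_norm_def by (intro AE_I2)
      qed
      have "(LINT y|lborel. complex_of_real (?P \<alpha> y) * f y)
          = (LINT y|lborel. complex_of_real (?P \<alpha> y) * (f y - f x) + complex_of_real (?P \<alpha> y) * f x)"
        by (simp add: algebra_simps)
      also have "\<dots> = (LINT y|lborel. complex_of_real (?P \<alpha> y) * (f y - f x)) + f x"
        using Pf P[OF \<alpha>] by (subst Bochner_Integration.integral_add) auto
      finally have "dist (LINT y|lborel. complex_of_real (?P \<alpha> y) * f y) (f x)
          = norm (LINT y|lborel. complex_of_real (?P \<alpha> y) * (f y - f x))"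
        by (simp add: dist_norm)
      also have "\<dots> \<le> integral\<^sup>L lborel ?g"
        by (rule Bochner_Integration.integral_norm_bound_integral[OF Pf g(1) bound])
      also have "\<dots> < e"
        using elim(1) unfolding g(2) .
      finally show "dist (LINT y|lborel. complex_of_real (?P \<alpha> y) * f y) (f x) < e" .
    qed
  qed
qed

section \<open>Uniform convergence on compact sets\<close>

theorem theorem1p3:
  fixes f :: "real \<times> real \<Rightarrow> complex" and \<Omega> :: "(real \<times> real) set"
  assumes "integrable lebesgue f"
    and "piecewise_smooth f"
    and "open \<Omega>"
    and "continuous_on \<Omega> f"
  shows "\<forall>K. compact K \<and> K \<subseteq> \<Omega> \<longrightarrow> uniform_limit K (\<lambda>\<alpha>. A_op \<alpha> f) f (at_right 0)"
proof (intro allI impI)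
  fix K assume K: "compact K \<and> K \<subseteq> \<Omega>"
  have f: "integrable lborel f"
    using assms(1) piecewise_smooth_borel_measurable[OF assms(2)] by (simp add: integrable_completion)
  have "\<forall>\<^sub>F \<alpha> in at_right 0. \<forall>x\<in>K.
      A_op \<alpha> f x = (LINT y|lborel. complex_of_real (poisson_kernel \<alpha> (x - y)) * f y)"
    using eventually_at_right_less[of 0] by eventually_elim (simp add: A_op_eq_poisson_convolution[OF _ f])
  moreover have "uniform_limit K (\<lambda>\<alpha> x. LINT y|lborel. complex_of_real (poisson_kernel \<alpha> (x - y)) * f y) f (at_right 0)"
    using uniform_limit_poisson_convolution[OF f assms(3,4)] K by blast
  ultimately show "uniform_limit K (\<lambda>\<alpha>. A_op \<alpha> f) f (at_right 0)"
    by (subst uniform_limit_cong) auto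
qed

end
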